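(* Let $f$ be a discrete Morse-Bott function on a Lefschetz complex $\mathbb{K}=(X,\dim,w)$, and let $\eta$ be a cell isolated in $\mathbb{K}$. Then $f$ is a discrete Morse-Bott function on $\mathbb{K}\{\eta\}$, $$P_t\bigl(\mathbb{K}\{\eta\}\bigr)=P_t(\mathbb{K})-t^{\dim\eta},\qquad P_t\bigl(\mathbb{W}(\mathbb{K}\{\eta\},f)\bigr)=P_t\bigl(\mathbb{W}(\mathbb{K},f)\bigr)-t^{\dim\eta},$$ and consequently $R_t(\mathbb{K},f)=R_t(\mathbb{K}\{\eta\},f)$.
   Context: A Lefschetz complex is a triple $\mathbb{K}=(X,\dim,w)$, where $X$ is a set (of cells), $\dim\colon X\to\mathbb{Z}_{\ge0}$ and $w\colon X\times X\to\mathbb{R}$ are functions, $\dim^{-1}(k)$ is finite for every $k$, and: (L1) $w(\tau,\sigma)\neq0$ implies $\dim\tau-\dim\sigma=1$; (L2) $\sum_{\sigma\in X}w(\tau,\sigma)w(\sigma,\nu)=0$ for all $\tau,\nu\in X$. A function on a complex is also regarded as a function on complexes with smaller cell set, by restriction. $C_k(\mathbb{K})$ is the real vector space with basis the $k$-cells (cells of dimension $k$), $C_{-1}(\mathbb{K})=\{0\}$, $\partial_k(\tau)=\sum_\sigma w(\tau,\sigma)\sigma$ for a $k$-cell $\tau$ (sum over $(k-1)$-cells), $B_k(\mathbb{K})=\operatorname{im}\partial_{k+1}$, $H_k(\mathbb{K})=\ker\partial_k/B_k(\mathbb{K})$, and $P_t(\mathbb{K})=\sum_{k\ge0}\operatorname{rank}H_k(\mathbb{K})\,t^k$.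 For $f\colon\mathbb{K}\to\mathbb{R}$ put $U^{\mathrm{snc}}(\sigma)=\#\{\tau\mid w(\tau,\sigma)\ne0,\ f(\sigma)>f(\tau)\}$, $D^{\mathrm{snc}}(\sigma)=\#\{\nu\mid w(\sigma,\nu)\ne0,\ f(\sigma)<f(\nu)\}$. $f$ is a discrete Morse-Bott function if $U^{\mathrm{snc}}(\sigma)\le1$ and $D^{\mathrm{snc}}(\sigma)\le1$ for all $\sigma$. A cell $\sigma$ is weakly critical if $U^{\mathrm{snc}}(\sigma)+D^{\mathrm{snc}}(\sigma)=0$. The weakly critical complex $\mathbb{W}(\mathbb{K},f)$ is the Lefschetz complex whose cells are the weakly critical cells, with the restricted dimension function and with incidence function equal to $w(\tau,\sigma)$ if $f(\tau)=f(\sigma)$ and $0$ otherwise. With $d_k^{\mathrm{snc}}(\mathbb{K},f)=\#\{k\text{-cells }\sigma\mid D^{\mathrm{snc}}(\sigma)=1\}$, $$R_t(\mathbb{K},f)=\sum_{k=1}^\infty\bigl(\operatorname{rank}B_{k-1}(\mathbb{K})-d_k^{\mathrm{snc}}(\mathbb{K},f)-\operatorname{rank}B_{k-1}(\mathbb{W}(\mathbb{K},f))\bigr)t^{k-1}.$$ A cell $\eta\in\mathbb{K}$ is isolated in $\mathbb{K}$ if $w(\sigma,\eta)=w(\eta,\sigma)=0$ for all $\sigma\in\mathbb{K}$. For such $\eta$, with $X'=X\setminus\{\eta\}$, $\mathbb{K}\{\eta\}$ is the Lefschetz complex $(X',\dim|_{X'},w|_{X'\times X'})$. *)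

theory Defs
  imports
    "HOL-Analysis.Finite_Function_Topology"
    "HOL-Library.Set_Algebras"
    "HOL-Computational_Algebra.Formal_Power_Series"
begin

section \<open>Quotients of real vector spaces\<close>

definition quotient_space :: "'v::real_vector set \<Rightarrow> 'v set \<Rightarrow> 'v set set" where
  "quotient_space V W = (\<lambda>v. v +o W) ` V"

text \<open>
  The linear combination, in a quotient by \<open>W\<close>, of the cosets in \<open>S\<close> with coefficients \<open>u\<close>. The sum
  is the elementwise sum of sets; adding \<open>W\<close> makes the result a coset even if \<open>S\<close> is empty or all
  coefficients vanish (scaling a coset elementwise by \<open>0\<close> gives \<open>{0}\<close> and not \<open>W\<close>).
\<close>

definition coset_lincomb :: "'v::real_vector set \<Rightarrow> ('v set \<Rightarrow> real) \<Rightarrow> 'v set set \<Rightarrow> 'v set" where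
  "coset_lincomb W u S = (\<Sum>A\<in>S. (\<lambda>a. u A *\<^sub>R a) ` A) + W"

definition quotient_basis :: "'v::real_vector set \<Rightarrow> 'v set \<Rightarrow> 'v set set \<Rightarrow> bool" where
  "quotient_basis V W S \<longleftrightarrow> finite S \<and> S \<subseteq> quotient_space V W \<and>
     (\<forall>q\<in>quotient_space V W. \<exists>!u. (\<forall>A. A \<notin> S \<longrightarrow> u A = 0) \<and> q = coset_lincomb W u S)"

text \<open>The dimension of \<open>V / W\<close>, meant for subspaces \<open>W \<subseteq> V\<close> with finite-dimensional quotient.\<close>

definition quotient_dim :: "'v::real_vector set \<Rightarrow> 'v set \<Rightarrow> nat" where
  "quotient_dim V W = (THE n. \<exists>S. quotient_basis V W S \<and> card S = n)"


section \<open>Lefschetz complexes\<close>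

text \<open>Values of \<open>cell_dim\<close> and \<open>inc\<close> outside of \<open>cells\<close> are irrelevant.\<close>

record 'a lefschetz =
  cells :: "'a set"
  cell_dim :: "'a \<Rightarrow> nat"
  inc :: "'a \<Rightarrow> 'a \<Rightarrow> real"

definition cells_of_dim :: "'a lefschetz \<Rightarrow> nat \<Rightarrow> 'a set" where
  "cells_of_dim K k = {\<sigma> \<in> cells K. cell_dim K \<sigma> = k}"

text \<open>
  The set of cells may be infinite. The sum in (L2) is therefore taken over the cells \<open>\<sigma>\<close> with
  \<open>inc K \<tau> \<sigma> \<noteq> 0\<close>, of which there are finitely many by the first two conditions; a sum over
  all of \<open>cells K\<close> would be \<open>0\<close> by convention for infinite complexes.
\<close>

definition lefschetz_complex :: "'a lefschetz \<Rightarrow> bool" where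
  "lefschetz_complex K \<longleftrightarrow>
     (\<forall>k. finite (cells_of_dim K k)) \<and>
     (\<forall>\<tau>\<in>cells K. \<forall>\<sigma>\<in>cells K. inc K \<tau> \<sigma> \<noteq> 0 \<longrightarrow> int (cell_dim K \<tau>) - int (cell_dim K \<sigma>) = 1) \<and>
     (\<forall>\<tau>\<in>cells K. \<forall>\<nu>\<in>cells K.
        (\<Sum>\<sigma> | \<sigma> \<in> cells K \<and> inc K \<tau> \<sigma> \<noteq> 0. inc K \<tau> \<sigma> * inc K \<sigma> \<nu>) = 0)"


subsection \<open>Homology\<close>

definition chains :: "'a lefschetz \<Rightarrow> nat \<Rightarrow> ('a \<Rightarrow>\<^sub>0 real) set" where
  "chains K k = {c. Poly_Mapping.keys c \<subseteq> cells_of_dim K k}"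

text \<open>
  The condition \<open>Suc (cell_dim K \<sigma>) = k\<close> selects the cells of dimension \<open>k - 1\<close>, and none if \<open>k = 0\<close>,
  so that the boundary operator on \<open>chains K 0\<close> is \<open>0\<close>.
\<close>

definition cell_boundary :: "'a lefschetz \<Rightarrow> nat \<Rightarrow> 'a \<Rightarrow> ('a \<Rightarrow>\<^sub>0 real)" where
  "cell_boundary K k \<tau> =
     (\<Sum>\<sigma> | \<sigma> \<in> cells K \<and> Suc (cell_dim K \<sigma>) = k. Poly_Mapping.single \<sigma> (inc K \<tau> \<sigma>))"

definition boundary :: "'a lefschetz \<Rightarrow> nat \<Rightarrow> ('a \<Rightarrow>\<^sub>0 real) \<Rightarrow> ('a \<Rightarrow>\<^sub>0 real)" where
  "boundary K k c = (\<Sum>\<tau>\<in>Poly_Mapping.keys c. Poly_Mapping.lookup c \<tau> *\<^sub>R cell_boundary K k \<tau>)"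

definition cycles :: "'a lefschetz \<Rightarrow> nat \<Rightarrow> ('a \<Rightarrow>\<^sub>0 real) set" where
  "cycles K k = {c \<in> chains K k. boundary K k c = 0}"

definition boundaries :: "'a lefschetz \<Rightarrow> nat \<Rightarrow> ('a \<Rightarrow>\<^sub>0 real) set" where
  "boundaries K k = boundary K (Suc k) ` chains K (Suc k)"

definition homology_rank :: "'a lefschetz \<Rightarrow> nat \<Rightarrow> nat" where
  "homology_rank K k = quotient_dim (cycles K k) (boundaries K k)"

text \<open>A formal power series, since there may be cells of arbitrarily large dimension.\<close>

definition poincare :: "'a lefschetz \<Rightarrow> int fps" where
  "poincare K = Abs_fps (\<lambda>k. int (homology_rank K k))"


subsection \<open>Discrete Morse-Bott functions\<close>

definition U_snc :: "'a lefschetz \<Rightarrow> ('a \<Rightarrow> real) \<Rightarrow> 'a \<Rightarrow> nat" where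
  "U_snc K f \<sigma> = card {\<tau> \<in> cells K. inc K \<tau> \<sigma> \<noteq> 0 \<and> f \<sigma> > f \<tau>}"

definition D_snc :: "'a lefschetz \<Rightarrow> ('a \<Rightarrow> real) \<Rightarrow> 'a \<Rightarrow> nat" where
  "D_snc K f \<sigma> = card {\<nu> \<in> cells K. inc K \<sigma> \<nu> \<noteq> 0 \<and> f \<sigma> < f \<nu>}"

definition discrete_morse_bott :: "'a lefschetz \<Rightarrow> ('a \<Rightarrow> real) \<Rightarrow> bool" where
  "discrete_morse_bott K f \<longleftrightarrow> (\<forall>\<sigma>\<in>cells K. U_snc K f \<sigma> \<le> 1 \<and> D_snc K f \<sigma> \<le> 1)"

definition weakly_critical :: "'a lefschetz \<Rightarrow> ('a \<Rightarrow> real) \<Rightarrow> 'a \<Rightarrow> bool" where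
  "weakly_critical K f \<sigma> \<longleftrightarrow> \<sigma> \<in> cells K \<and> U_snc K f \<sigma> + D_snc K f \<sigma> = 0"

definition weakly_critical_complex :: "'a lefschetz \<Rightarrow> ('a \<Rightarrow> real) \<Rightarrow> 'a lefschetz" where
  "weakly_critical_complex K f =
     \<lparr>cells = {\<sigma>. weakly_critical K f \<sigma>},
      cell_dim = cell_dim K,
      inc = (\<lambda>\<tau> \<sigma>. if f \<tau> = f \<sigma> then inc K \<tau> \<sigma> else 0)\<rparr>"

definition d_snc :: "'a lefschetz \<Rightarrow> ('a \<Rightarrow> real) \<Rightarrow> nat \<Rightarrow> nat" where
  "d_snc K f k = card {\<sigma> \<in> cells_of_dim K k. D_snc K f \<sigma> = 1}"

text \<open>The summand for \<open>k \<ge> 1\<close> is the coefficient of \<open>t\<^sup>j\<close> with \<open>j = k - 1\<close>.\<close>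

definition R_series :: "'a lefschetz \<Rightarrow> ('a \<Rightarrow> real) \<Rightarrow> int fps" where
  "R_series K f = Abs_fps (\<lambda>j. int (dim (boundaries K j)) - int (d_snc K f (Suc j))
     - int (dim (boundaries (weakly_critical_complex K f) j)))"


subsection \<open>Removal of isolated cells\<close>

definition isolated_cell :: "'a lefschetz \<Rightarrow> 'a \<Rightarrow> bool" where
  "isolated_cell K \<eta> \<longleftrightarrow> \<eta> \<in> cells K \<and> (\<forall>\<sigma>\<in>cells K. inc K \<sigma> \<eta> = 0 \<and> inc K \<eta> \<sigma> = 0)"

definition remove_cell :: "'a lefschetz \<Rightarrow> 'a \<Rightarrow> 'a lefschetz" where
  "remove_cell K \<eta> = K\<lparr>cells := cells K - {\<eta>}\<rparr>"

lemma lefschetz_complex_remove_cell: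
  assumes K: "lefschetz_complex K" and \<eta>: "isolated_cell K \<eta>"
  shows "lefschetz_complex (remove_cell K \<eta>)"
proof -
  have fin: "finite (cells_of_dim (remove_cell K \<eta>) k)" for k
  proof (rule finite_subset)
    show "cells_of_dim (remove_cell K \<eta>) k \<subseteq> cells_of_dim K k"
      by (auto simp: remove_cell_def cells_of_dim_def)
    show "finite (cells_of_dim K k)"
      using K by (simp add: lefschetz_complex_def)
  qed
  have eq: "{\<sigma>. \<sigma> \<in> cells K \<and> \<sigma> \<noteq> \<eta> \<and> inc K \<tau> \<sigma> \<noteq> 0} = {\<sigma>. \<sigma> \<in> cells K \<and> inc K \<tau> \<sigma> \<noteq> 0}"
    if "\<tau> \<in> cells K" for \<tau>
    using \<eta> that by (auto simp: isolated_cell_def)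
  show ?thesis
    unfolding lefschetz_complex_def using fin K
    by (simp add: remove_cell_def eq) (simp add: lefschetz_complex_def)
qed

lemma lefschetz_complex_weakly_critical_complex:
  assumes K: "lefschetz_complex K" and f: "discrete_morse_bott K f"
  shows "lefschetz_complex (weakly_critical_complex K f)"
proof -
  let ?W = "weakly_critical_complex K f"
  have fink: "finite (cells_of_dim K k)" for k
    using K by (simp add: lefschetz_complex_def)
  have L1: "cell_dim K \<tau> = Suc (cell_dim K \<sigma>)"
    if "\<tau> \<in> cells K" "\<sigma> \<in> cells K" "inc K \<tau> \<sigma> \<noteq> 0" for \<tau> \<sigma>
  proof -
    have "int (cell_dim K \<tau>) - int (cell_dim K \<sigma>) = 1"
      using K that unfolding lefschetz_complex_def by blast
    then show ?thesis by simp
  qed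
  have L2: "(\<Sum>\<sigma> | \<sigma> \<in> cells K \<and> inc K \<tau> \<sigma> \<noteq> 0. inc K \<tau> \<sigma> * inc K \<sigma> \<nu>) = 0"
    if "\<tau> \<in> cells K" "\<nu> \<in> cells K" for \<tau> \<nu>
    using K that by (simp add: lefschetz_complex_def)
  have fin_faces: "finite {\<sigma> \<in> cells K. inc K \<tau> \<sigma> \<noteq> 0}" if "\<tau> \<in> cells K" for \<tau>
    by (rule finite_subset[OF _ fink[of "cell_dim K \<tau> - 1"]])
      (auto simp: cells_of_dim_def dest: L1[OF that])
  have fin_cofaces: "finite {\<tau> \<in> cells K. inc K \<tau> \<sigma> \<noteq> 0}" if "\<sigma> \<in> cells K" for \<sigma>
    by (rule finite_subset[OF _ fink[of "Suc (cell_dim K \<sigma>)"]])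
      (auto simp: cells_of_dim_def dest: L1[OF _ that])
  have finU: "finite {\<tau> \<in> cells K. inc K \<tau> \<sigma> \<noteq> 0 \<and> f \<sigma> > f \<tau>}" if "\<sigma> \<in> cells K" for \<sigma>
    by (rule finite_subset[OF _ fin_cofaces[OF that]]) auto
  have finD: "finite {\<nu> \<in> cells K. inc K \<sigma> \<nu> \<noteq> 0 \<and> f \<sigma> < f \<nu>}" if "\<sigma> \<in> cells K" for \<sigma>
    by (rule finite_subset[OF _ fin_faces[OF that]]) auto
  have uniqU: "a = b" if "\<sigma> \<in> cells K" "a \<in> cells K" "b \<in> cells K" "inc K a \<sigma> \<noteq> 0" "inc K b \<sigma> \<noteq> 0"
    "f \<sigma> > f a" "f \<sigma> > f b" for \<sigma> a b
  proof -
    have "card {\<tau> \<in> cells K. inc K \<tau> \<sigma> \<noteq> 0 \<and> f \<sigma> > f \<tau>} \<le> Suc 0"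
      using f that by (simp add: discrete_morse_bott_def U_snc_def)
    then show ?thesis
      using that card_le_Suc0_iff_eq[OF finU[OF that(1)]] by blast
  qed
  have uniqD: "a = b" if "\<sigma> \<in> cells K" "a \<in> cells K" "b \<in> cells K" "inc K \<sigma> a \<noteq> 0" "inc K \<sigma> b \<noteq> 0"
    "f \<sigma> < f a" "f \<sigma> < f b" for \<sigma> a b
  proof -
    have "card {\<nu> \<in> cells K. inc K \<sigma> \<nu> \<noteq> 0 \<and> f \<sigma> < f \<nu>} \<le> Suc 0"
      using f that by (simp add: discrete_morse_bott_def D_snc_def)
    then show ?thesis
      using that card_le_Suc0_iff_eq[OF finD[OF that(1)]] by blast
  qed
  have wc: "weakly_critical K f \<sigma> \<longleftrightarrow> \<sigma> \<in> cells K \<and>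
      (\<forall>\<tau>\<in>cells K. inc K \<tau> \<sigma> \<noteq> 0 \<longrightarrow> f \<sigma> \<le> f \<tau>) \<and> (\<forall>\<nu>\<in>cells K. inc K \<sigma> \<nu> \<noteq> 0 \<longrightarrow> f \<nu> \<le> f \<sigma>)" for \<sigma>
    unfolding weakly_critical_def U_snc_def D_snc_def
    using finU[of \<sigma>] finD[of \<sigma>] by (auto simp: not_less)
  have other: "\<exists>\<sigma>'\<in>cells K. \<sigma>' \<noteq> \<sigma> \<and> inc K \<tau> \<sigma>' \<noteq> 0 \<and> inc K \<sigma>' \<nu> \<noteq> 0"
    if "\<tau> \<in> cells K" "\<sigma> \<in> cells K" "\<nu> \<in> cells K" "inc K \<tau> \<sigma> \<noteq> 0" "inc K \<sigma> \<nu> \<noteq> 0" for \<tau> \<sigma> \<nu>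
  proof (rule ccontr)
    assume "\<not> ?thesis"
    then have "(\<Sum>\<sigma>' | \<sigma>' \<in> cells K \<and> inc K \<tau> \<sigma>' \<noteq> 0. inc K \<tau> \<sigma>' * inc K \<sigma>' \<nu>)
        = (\<Sum>\<sigma>'\<in>{\<sigma>}. inc K \<tau> \<sigma>' * inc K \<sigma>' \<nu>)"
      using that fin_faces[OF that(1)] by (intro sum.mono_neutral_right) auto
    with L2[OF that(1,3)] that show False by simp
  qed
  have key: "weakly_critical K f \<sigma>"
    if \<tau>: "weakly_critical K f \<tau>" and \<nu>: "weakly_critical K f \<nu>" and eq: "f \<tau> = f \<nu>"
      and \<sigma>: "\<sigma> \<in> cells K" "inc K \<tau> \<sigma> \<noteq> 0" "inc K \<sigma> \<nu> \<noteq> 0" for \<tau> \<sigma> \<nu>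
  proof -
    have "f \<sigma> = f \<tau>" using \<tau> \<nu> eq \<sigma> by (auto simp: wc intro: antisym)
    have "f \<sigma> \<le> f \<tau>'" if \<tau>': "\<tau>' \<in> cells K" "inc K \<tau>' \<sigma> \<noteq> 0" for \<tau>'
    proof (rule ccontr)
      assume less: "\<not> ?thesis"
      obtain \<sigma>' where s: "\<sigma>' \<in> cells K" "\<sigma>' \<noteq> \<sigma>" "inc K \<tau>' \<sigma>' \<noteq> 0" "inc K \<sigma>' \<nu> \<noteq> 0"
        using other[OF \<tau>'(1) \<sigma>(1) _ \<tau>'(2) \<sigma>(3)] \<nu> by (auto simp: wc)
      then have "f \<nu> \<le> f \<sigma>'" using \<nu> by (auto simp: wc)
      with less eq \<open>f \<sigma> = f \<tau>\<close> have "f \<tau>' < f \<sigma>'" "f \<tau>' < f \<sigma>" by auto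
      with uniqD[OF \<tau>'(1) s(1) \<sigma>(1) s(3) \<tau>'(2)] s(2) show False by blast
    qed
    moreover have "f \<nu>' \<le> f \<sigma>" if \<nu>': "\<nu>' \<in> cells K" "inc K \<sigma> \<nu>' \<noteq> 0" for \<nu>'
    proof (rule ccontr)
      assume less: "\<not> ?thesis"
      obtain \<sigma>' where s: "\<sigma>' \<in> cells K" "\<sigma>' \<noteq> \<sigma>" "inc K \<tau> \<sigma>' \<noteq> 0" "inc K \<sigma>' \<nu>' \<noteq> 0"
        using other[OF _ \<sigma>(1) \<nu>'(1) \<sigma>(2) \<nu>'(2)] \<tau> by (auto simp: wc)
      then have "f \<sigma>' \<le> f \<tau>" using \<tau> by (auto simp: wc)
      with less \<open>f \<sigma> = f \<tau>\<close> have "f \<nu>' > f \<sigma>'" "f \<nu>' > f \<sigma>" by auto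
      with uniqU[OF \<nu>'(1) s(1) \<sigma>(1) s(4) \<nu>'(2)] s(2) show False by blast
    qed
    ultimately show ?thesis using \<sigma>(1) by (auto simp: wc)
  qed
  have "finite (cells_of_dim ?W k)" for k
    by (rule finite_subset[OF _ fink[of k]])
      (auto simp: cells_of_dim_def weakly_critical_complex_def wc)
  moreover have "int (cell_dim ?W \<tau>) - int (cell_dim ?W \<sigma>) = 1"
    if "\<tau> \<in> cells ?W" "\<sigma> \<in> cells ?W" "inc ?W \<tau> \<sigma> \<noteq> 0" for \<tau> \<sigma>
    using that L1[of \<tau> \<sigma>] by (auto simp: weakly_critical_complex_def wc split: if_splits)
  moreover have "(\<Sum>\<sigma> | \<sigma> \<in> cells ?W \<and> inc ?W \<tau> \<sigma> \<noteq> 0. inc ?W \<tau> \<sigma> * inc ?W \<sigma> \<nu>) = 0"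
    if "\<tau> \<in> cells ?W" "\<nu> \<in> cells ?W" for \<tau> \<nu>
  proof -
    have \<tau>: "weakly_critical K f \<tau>" and \<nu>: "weakly_critical K f \<nu>"
      using that by (auto simp: weakly_critical_complex_def)
    then have mem: "\<tau> \<in> cells K" "\<nu> \<in> cells K" by (auto simp: wc)
    show ?thesis
    proof (cases "f \<tau> = f \<nu>")
      case False
      then show ?thesis
        by (intro sum.neutral) (auto simp: weakly_critical_complex_def)
    next
      case True
      have "(\<Sum>\<sigma> | \<sigma> \<in> cells ?W \<and> inc ?W \<tau> \<sigma> \<noteq> 0. inc ?W \<tau> \<sigma> * inc ?W \<sigma> \<nu>)
          = (\<Sum>\<sigma> | \<sigma> \<in> cells K \<and> inc K \<tau> \<sigma> \<noteq> 0. inc K \<tau> \<sigma> * inc K \<sigma> \<nu>)"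
      proof (rule sum.mono_neutral_cong_left)
        show "finite {\<sigma>. \<sigma> \<in> cells K \<and> inc K \<tau> \<sigma> \<noteq> 0}" by (rule fin_faces[OF mem(1)])
        show "{\<sigma>. \<sigma> \<in> cells ?W \<and> inc ?W \<tau> \<sigma> \<noteq> 0} \<subseteq> {\<sigma>. \<sigma> \<in> cells K \<and> inc K \<tau> \<sigma> \<noteq> 0}"
          by (auto simp: weakly_critical_complex_def wc split: if_splits)
        show "\<forall>\<sigma>\<in>{\<sigma>. \<sigma> \<in> cells K \<and> inc K \<tau> \<sigma> \<noteq> 0} - {\<sigma>. \<sigma> \<in> cells ?W \<and> inc ?W \<tau> \<sigma> \<noteq> 0}.
            inc K \<tau> \<sigma> * inc K \<sigma> \<nu> = 0"
        proof
          fix \<sigma>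
          assume s: "\<sigma> \<in> {\<sigma>. \<sigma> \<in> cells K \<and> inc K \<tau> \<sigma> \<noteq> 0} - {\<sigma>. \<sigma> \<in> cells ?W \<and> inc ?W \<tau> \<sigma> \<noteq> 0}"
          show "inc K \<tau> \<sigma> * inc K \<sigma> \<nu> = 0"
          proof (rule ccontr)
            assume "inc K \<tau> \<sigma> * inc K \<sigma> \<nu> \<noteq> 0"
            then have nz: "inc K \<tau> \<sigma> \<noteq> 0" "inc K \<sigma> \<nu> \<noteq> 0" by auto
            have "weakly_critical K f \<sigma>" using key[OF \<tau> \<nu> True] s nz by auto
            moreover have "f \<sigma> = f \<tau>" using s nz \<tau> \<nu> True by (auto simp: wc intro: antisym)
            ultimately show False using s nz by (auto simp: weakly_critical_complex_def)
          qed
        qed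
        show "inc ?W \<tau> \<sigma> * inc ?W \<sigma> \<nu> = inc K \<tau> \<sigma> * inc K \<sigma> \<nu>"
          if "\<sigma> \<in> {\<sigma>. \<sigma> \<in> cells ?W \<and> inc ?W \<tau> \<sigma> \<noteq> 0}" for \<sigma>
          using that True by (auto simp: weakly_critical_complex_def split: if_splits)
      qed
      with L2[OF mem] show ?thesis by simp
    qed
  qed
  ultimately show ?thesis
    unfolding lefschetz_complex_def by blast
qed

end

theory Submission
  imports Defs
begin

text \<open>
  The boundary of an isolated cell \<open>\<eta>\<close> is zero, and \<open>\<eta>\<close> occurs in no boundary. The chain complex of
  \<open>K\<close> is therefore the direct sum of the chain complex of \<open>remove_cell K \<eta>\<close> and of the line spanned
  by \<open>\<eta>\<close> in degree \<open>k = cell_dim K \<eta>\<close>, with zero boundary operators on that line. Hence removing \<open>\<eta>\<close>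
  changes no space of boundaries (\<open>boundaries_remove_cell\<close>), and the cycles change only in degree
  \<open>k\<close>, where they lose the one dimension contributed by \<open>\<eta>\<close> (\<open>cycles_eq_span_insert\<close>). Ranks of
  homology are differences of dimensions of cycles and boundaries (\<open>homology_rank_eq\<close>), so the
  Poincare series loses exactly one term (\<open>poincare_remove_cell\<close>).

  An isolated cell is not counted by any \<open>U_snc\<close> or \<open>D_snc\<close>, and its own two numbers vanish.
  Thus it is weakly critical, forming the weakly critical complex commutes with removing it
  (\<open>weakly_critical_complex_remove_cell\<close>), and it stays isolated there. The statement on the
  Poincare series of the weakly critical complex is therefore the previous one applied to that
  complex, and each of the three terms in the coefficients of \<open>R_series\<close> is unchanged.

  Since homology ranks are defined by bases of cosets, a preliminary part shows that for subspaces
  \<open>W \<subseteq> V\<close> of finite dimension this notion of dimension gives \<open>dim V - dim W\<close>. The ambient space of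
  chains may have infinite dimension, so finiteness enters through a finite set whose span
  contains \<open>V\<close>.
\<close>

section \<open>The dimension of a quotient\<close>

lemma coset_eq_iff:
  assumes "subspace W"
  shows "x +o W = y +o W \<longleftrightarrow> x - y \<in> W"
proof
  assume "x +o W = y +o W"
  moreover have "x \<in> x +o W"
    using set_plus_intro2[of 0 W x] subspace_0[OF assms] by simp
  ultimately show "x - y \<in> W"
    by (simp add: set_minus_plus)
next
  assume xy: "x - y \<in> W"
  have "z - x \<in> W \<longleftrightarrow> z - y \<in> W" for z
    using subspace_add[OF assms _ xy, of "z - x"] subspace_diff[OF assms _ xy, of "z - y"] by auto
  then show "x +o W = y +o W"
    by (auto simp flip: set_minus_plus)
qed

lemma scaleR_image_coset:
  fixes W :: "'v::real_vector set"
  assumes W: "subspace W" and a: "a \<noteq> 0"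
  shows "(\<lambda>x. a *\<^sub>R x) ` (v +o W) = (a *\<^sub>R v) +o W"
proof
  show "(\<lambda>x. a *\<^sub>R x) ` (v +o W) \<subseteq> (a *\<^sub>R v) +o W"
  proof
    fix y assume "y \<in> (\<lambda>x. a *\<^sub>R x) ` (v +o W)"
    then obtain w where "w \<in> W" and y: "y = a *\<^sub>R v + a *\<^sub>R w"
      unfolding elt_set_plus_def by (force simp: scaleR_add_right)
    then show "y \<in> (a *\<^sub>R v) +o W"
      unfolding y by (intro set_plus_intro2 subspace_scale[OF W])
  qed
  show "(a *\<^sub>R v) +o W \<subseteq> (\<lambda>x. a *\<^sub>R x) ` (v +o W)"
  proof
    fix y assume "y \<in> (a *\<^sub>R v) +o W"
    then obtain w where "w \<in> W" and y: "y = a *\<^sub>R v + w"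
      unfolding elt_set_plus_def by blast
    show "y \<in> (\<lambda>x. a *\<^sub>R x) ` (v +o W)"
    proof (rule image_eqI)
      show "y = a *\<^sub>R (v + (1 / a) *\<^sub>R w)"
        using a by (simp add: y scaleR_add_right)
      show "v + (1 / a) *\<^sub>R w \<in> v +o W"
        using subspace_scale[OF W \<open>w \<in> W\<close>] by (rule set_plus_intro2)
    qed
  qed
qed

lemma subspace_plus_self:
  assumes "subspace W"
  shows "W + W = W"
proof
  show "W + W \<subseteq> W"
    using subspace_add[OF assms] by (blast elim: set_plus_elim)
  show "W \<subseteq> W + W"
    by (rule set_zero_plus2[OF subspace_0[OF assms]])
qed

text \<open>
  Replaces the elementwise arithmetic of sets in \<open>coset_lincomb\<close> by a linear combination of vectors.
  A coset with coefficient \<open>0\<close> contributes \<open>{0}\<close> instead of \<open>W\<close>; the summand \<open>W\<close> in the definition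
  absorbs the difference.
\<close>

lemma coset_lincomb_representatives:
  fixes W :: "'v::real_vector set"
  assumes W: "subspace W" and "finite S" and "\<forall>A\<in>S. r A +o W = A"
  shows "coset_lincomb W u S = (\<Sum>A\<in>S. u A *\<^sub>R r A) +o W"
  using assms(2,3)
proof (induction S)
  case empty
  then show ?case by (simp add: coset_lincomb_def)
next
  case (insert A S)
  have "coset_lincomb W u (insert A S) = (\<lambda>a. u A *\<^sub>R a) ` A + coset_lincomb W u S"
    using insert.hyps by (simp add: coset_lincomb_def add.assoc)
  also have "\<dots> = (\<lambda>a. u A *\<^sub>R a) ` (r A +o W) + ((\<Sum>A\<in>S. u A *\<^sub>R r A) +o W)"
    using insert by simp
  also have "\<dots> = (u A *\<^sub>R r A + (\<Sum>A\<in>S. u A *\<^sub>R r A)) +o W"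
  proof (cases "u A = 0")
    case True
    have "(\<lambda>a. u A *\<^sub>R a) ` (r A +o W) = 0"
      using True subspace_0[OF W] unfolding elt_set_plus_def set_zero by auto
    with True show ?thesis by simp
  next
    case False
    then show ?thesis
      by (simp add: scaleR_image_coset[OF W] set_plus_rearrange subspace_plus_self[OF W])
  qed
  finally show ?case using insert.hyps by simp
qed

lemma finite_basis_of_subspace:
  fixes V :: "'v::real_vector set"
  assumes "subspace V" "V \<subseteq> span F" "finite F"
  obtains B where "finite B" "independent B" "span B = V" "card B = dim V"
proof -
  obtain B where B: "B \<subseteq> V" "independent B" "V \<subseteq> span B" "card B = dim V"
    by (rule basis_exists)
  moreover have "finite B"
    using independent_span_bound[OF \<open>finite F\<close> B(2)] B(1) assms(2) by auto
  moreover have "span B = V"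
    using B(1,3) assms(1) by (rule span_subspace)
  ultimately show ?thesis using that by blast
qed

text \<open>
  Uniqueness of coefficients means that representatives of the cosets in \<open>S\<close> are linearly
  independent modulo \<open>W\<close>, and existence that they span \<open>V\<close> modulo \<open>W\<close>. Together with a basis of \<open>W\<close>
  they form a basis of \<open>V\<close>.
\<close>

lemma card_quotient_basis:
  fixes V W :: "'v::real_vector set"
  assumes W: "subspace W" "W \<subseteq> V" and V: "subspace V" "V \<subseteq> span F" "finite F"
    and S: "quotient_basis V W S"
  shows "card S = dim V - dim W"
proof -
  have fin: "finite S" and SV: "S \<subseteq> quotient_space V W"
    and uniq: "\<forall>q\<in>quotient_space V W. \<exists>!u. (\<forall>A. A \<notin> S \<longrightarrow> u A = 0) \<and> q = coset_lincomb W u S"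
    using S by (simp_all add: quotient_basis_def)
  obtain B where B: "finite B" "independent B" "span B = W" "card B = dim W"
    using finite_basis_of_subspace[of W F] W V by auto
  have "\<forall>A\<in>S. \<exists>v. v \<in> V \<and> A = v +o W"
    using SV by (auto simp: quotient_space_def)
  then obtain r where r: "\<forall>A\<in>S. r A \<in> V \<and> r A +o W = A"
    by metis
  then have lincomb: "coset_lincomb W u S = (\<Sum>A\<in>S. u A *\<^sub>R r A) +o W" for u
    by (intro coset_lincomb_representatives[OF W(1) fin]) auto
  have inj: "inj_on r S"
    using r by (metis inj_on_def)
  \<comment> \<open>The representatives are linearly independent modulo \<open>W\<close>: compare with the zero coefficients.\<close>
  have zero: "\<forall>A\<in>S. u A = 0" if "(\<Sum>A\<in>S. u A *\<^sub>R r A) \<in> W" for u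
  proof -
    let ?u = "\<lambda>A. if A \<in> S then u A else 0"
    have "(\<Sum>A\<in>S. ?u A *\<^sub>R r A) = (\<Sum>A\<in>S. u A *\<^sub>R r A)"
      by (rule sum.cong) auto
    with that have "0 +o W = coset_lincomb W ?u S"
      unfolding lincomb coset_eq_iff[OF W(1)] using subspace_neg[OF W(1)] by fastforce
    then have 1: "(\<forall>A. A \<notin> S \<longrightarrow> ?u A = 0) \<and> 0 +o W = coset_lincomb W ?u S" by simp
    have 2: "(\<forall>A. A \<notin> S \<longrightarrow> (\<lambda>A. 0::real) A = 0) \<and> 0 +o W = coset_lincomb W (\<lambda>A. 0) S"
      unfolding lincomb by simp
    have "0 +o W \<in> quotient_space V W"
      using subspace_0[OF V(1)] unfolding quotient_space_def by (rule imageI)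
    then have "\<exists>\<^sub>\<le>\<^sub>1u. (\<forall>A. A \<notin> S \<longrightarrow> u A = 0) \<and> 0 +o W = coset_lincomb W u S"
      by (rule conjunct2[OF bspec[OF uniq[unfolded ex1_iff_ex_Uniq]]])
    from Uniq_D[OF this, of ?u "\<lambda>A. 0"] 1 2 have "?u = (\<lambda>A. 0)" by simp
    then show ?thesis by metis
  qed
  have "r A \<notin> W" if "A \<in> S" for A
  proof
    assume "r A \<in> W"
    moreover have "(\<Sum>A'\<in>S. (if A' = A then 1 else 0) *\<^sub>R r A') = (\<Sum>A'\<in>{A}. r A')"
      using that fin by (intro sum.mono_neutral_cong_right) auto
    ultimately have "(\<Sum>A'\<in>S. (if A' = A then 1 else 0) *\<^sub>R r A') \<in> W"
      by simp
    from zero[OF this] that show False by auto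
  qed
  then have disj: "B \<inter> r ` S = {}"
    using B(3) span_base by blast
  have "independent (B \<union> r ` S)"
  proof
    assume "dependent (B \<union> r ` S)"
    then obtain u where u: "\<exists>v\<in>B \<union> r ` S. u v \<noteq> 0" "(\<Sum>v\<in>B \<union> r ` S. u v *\<^sub>R v) = 0"
      using dependent_finite[of "B \<union> r ` S"] B(1) fin by auto
    have sum0: "(\<Sum>v\<in>B. u v *\<^sub>R v) + (\<Sum>A\<in>S. u (r A) *\<^sub>R r A) = 0"
      using u(2) disj B(1) fin by (simp add: sum.union_disjoint sum.reindex[OF inj])
    have "(\<Sum>v\<in>B. u v *\<^sub>R v) \<in> W"
      unfolding B(3)[symmetric] by (intro span_sum span_scale span_base)
    then have "(\<Sum>A\<in>S. u (r A) *\<^sub>R r A) \<in> W"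
      using sum0 subspace_neg[OF W(1)] by (metis add_eq_0_iff)
    then have uS: "\<forall>A\<in>S. u (r A) = 0" by (rule zero)
    then have "(\<Sum>v\<in>B. u v *\<^sub>R v) = 0"
      using sum0 by simp
    then have "\<forall>v\<in>B. u v = 0"
      using independentD[OF B(2,1) subset_refl] by blast
    with uS u(1) show False by auto
  qed
  moreover have "V \<subseteq> span (B \<union> r ` S)"
  proof
    fix v assume "v \<in> V"
    then obtain u where "v +o W = coset_lincomb W u S"
      using uniq ex1_implies_ex unfolding quotient_space_def by (metis (no_types, lifting) imageI)
    then have "v - (\<Sum>A\<in>S. u A *\<^sub>R r A) \<in> span B"
      using B(3) coset_eq_iff[OF W(1)] by (simp add: lincomb)
    then have "v - (\<Sum>A\<in>S. u A *\<^sub>R r A) \<in> span (B \<union> r ` S)"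
      using span_mono[of B "B \<union> r ` S"] by auto
    moreover have "(\<Sum>A\<in>S. u A *\<^sub>R r A) \<in> span (B \<union> r ` S)"
      by (intro span_sum span_scale span_base) auto
    ultimately show "v \<in> span (B \<union> r ` S)"
      using span_add by fastforce
  qed
  moreover have "B \<union> r ` S \<subseteq> V"
    using B(3) W(2) r span_base by blast
  ultimately have "card (B \<union> r ` S) = dim V"
    using basis_card_eq_dim by blast
  moreover have "card (B \<union> r ` S) = card B + card S"
    using disj B(1) fin inj by (simp add: card_Un_disjoint card_image)
  ultimately show ?thesis using B(4) by simp
qed

text \<open>
  Extend a basis of \<open>W\<close> to a basis of \<open>V\<close>; the cosets of the added vectors form a basis of the quotient.
\<close>

lemma quotient_basis_exists:
  fixes V W :: "'v::real_vector set"
  assumes W: "subspace W" "W \<subseteq> V" and V: "subspace V" "V \<subseteq> span F" "finite F"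
  shows "\<exists>S. quotient_basis V W S"
proof -
  obtain B where B: "finite B" "independent B" "span B = W"
    by (rule finite_basis_of_subspace[OF W(1) order_trans[OF W(2) V(2)] V(3)])
  have "B \<subseteq> V" using B(3) W(2) span_base by blast
  then obtain B' where B': "B \<subseteq> B'" "B' \<subseteq> V" "independent B'" "V \<subseteq> span B'"
    by (rule maximal_independent_subset_extend[OF _ B(2)])
  have "finite B'"
    using independent_span_bound[OF V(3) B'(3)] B'(2) V(2) by blast
  define C where "C = B' - B"
  define S where "S = (\<lambda>v. v +o W) ` C"
  have finC: "finite C" using \<open>finite B'\<close> by (simp add: C_def)
  have disj: "B \<inter> C = {}" and Un: "B' = B \<union> C"
    using B'(1) unfolding C_def by blast+
  \<comment> \<open>The added vectors are linearly independent modulo \<open>W\<close>, which is the span of \<open>B\<close>.\<close>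
  have zero: "\<forall>v\<in>C. u v = 0" if "(\<Sum>v\<in>C. u v *\<^sub>R v) \<in> W" for u
  proof -
    have "(\<Sum>v\<in>C. u v *\<^sub>R v) \<in> range (\<lambda>t. \<Sum>v\<in>B. t v *\<^sub>R v)"
      using that unfolding span_finite[OF B(1), symmetric] B(3) .
    then obtain t where t: "(\<Sum>v\<in>C. u v *\<^sub>R v) = (\<Sum>v\<in>B. t v *\<^sub>R v)"
      by (rule rangeE)
    let ?u = "\<lambda>v. if v \<in> C then u v else - t v"
    have "(\<Sum>v\<in>B'. ?u v *\<^sub>R v) = (\<Sum>v\<in>B. ?u v *\<^sub>R v) + (\<Sum>v\<in>C. ?u v *\<^sub>R v)"
      unfolding Un by (rule sum.union_disjoint[OF B(1) finC disj])
    also have "(\<Sum>v\<in>B. ?u v *\<^sub>R v) = (\<Sum>v\<in>B. - (t v *\<^sub>R v))"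
    proof (rule sum.cong)
      fix v assume "v \<in> B"
      then have "v \<notin> C" using disj by blast
      then show "?u v *\<^sub>R v = - (t v *\<^sub>R v)" by simp
    qed simp
    also have "(\<Sum>v\<in>C. ?u v *\<^sub>R v) = (\<Sum>v\<in>C. u v *\<^sub>R v)"
      by (rule sum.cong) simp_all
    finally have "(\<Sum>v\<in>B'. ?u v *\<^sub>R v) = 0"
      unfolding t sum_negf by simp
    then have "?u v = 0" if "v \<in> B'" for v
      using that by (rule independentD[OF B'(3) \<open>finite B'\<close> subset_refl])
    then have "?u v = 0" if "v \<in> C" for v
      using that unfolding Un by blast
    then show ?thesis by simp
  qed
  have inj: "inj_on (\<lambda>v. v +o W) C"
  proof (rule inj_onI, rule ccontr)
    fix x y assume x: "x \<in> C" and y: "y \<in> C" and "x +o W = y +o W" and "x \<noteq> y"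
    \<comment> \<open>Coefficients expressing \<open>x - y\<close>, an element of \<open>W\<close>, in the vectors of \<open>C\<close>.\<close>
    let ?u = "\<lambda>v. if v = x then 1 else if v = y then - 1 else 0 :: real"
    have "(\<Sum>v\<in>C. ?u v *\<^sub>R v) = (\<Sum>v\<in>{x, y}. ?u v *\<^sub>R v)"
      using x y finC by (intro sum.mono_neutral_right) auto
    also have "\<dots> = x - y" using \<open>x \<noteq> y\<close> by simp
    also have "\<dots> \<in> W" using \<open>x +o W = y +o W\<close> coset_eq_iff[OF W(1)] by blast
    finally have "?u x = 0" using zero[of ?u] x by blast
    then show False by simp
  qed
  define r where "r = the_inv_into C (\<lambda>v. v +o W)"
  have rC: "r (v +o W) = v" if "v \<in> C" for v
    unfolding r_def using the_inv_into_f_f[OF inj that] .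
  then have r: "\<forall>A\<in>S. r A +o W = A"
    by (simp add: S_def)
  have lincomb: "coset_lincomb W u S = (\<Sum>v\<in>C. u (v +o W) *\<^sub>R v) +o W" for u
  proof -
    have "coset_lincomb W u S = (\<Sum>A\<in>S. u A *\<^sub>R r A) +o W"
      using finC by (intro coset_lincomb_representatives[OF W(1) _ r]) (simp add: S_def)
    also have "(\<Sum>A\<in>S. u A *\<^sub>R r A) = (\<Sum>v\<in>C. u (v +o W) *\<^sub>R v)"
      unfolding S_def by (simp add: sum.reindex[OF inj] rC)
    finally show ?thesis .
  qed
  have "quotient_basis V W S"
    unfolding quotient_basis_def
  proof (intro conjI ballI)
    show "finite S" using finC by (simp add: S_def)
    show "S \<subseteq> quotient_space V W"
      using B'(2) by (auto simp: S_def C_def quotient_space_def)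
    fix q assume "q \<in> quotient_space V W"
    then obtain v where v: "v \<in> V" "q = v +o W" by (auto simp: quotient_space_def)
    then have "v \<in> span (B \<union> C)" using B'(4) unfolding Un by blast
    then obtain x y where xy: "v = x + y" "x \<in> W" "y \<in> span C"
      unfolding span_Un B(3) by blast
    have "y \<in> range (\<lambda>t. \<Sum>v\<in>C. t v *\<^sub>R v)"
      using xy(3) unfolding span_finite[OF finC] .
    then obtain t where t: "y = (\<Sum>v\<in>C. t v *\<^sub>R v)"
      by (rule rangeE)
    show "\<exists>!u. (\<forall>A. A \<notin> S \<longrightarrow> u A = 0) \<and> q = coset_lincomb W u S"
    proof (rule ex1I)
      let ?u = "\<lambda>A. if A \<in> S then t (r A) else 0"
      have "(\<Sum>v\<in>C. ?u (v +o W) *\<^sub>R v) = y"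
        unfolding t by (intro sum.cong) (auto simp: S_def rC)
      then show "(\<forall>A. A \<notin> S \<longrightarrow> ?u A = 0) \<and> q = coset_lincomb W ?u S"
        using xy v(2) coset_eq_iff[OF W(1), of v y] by (simp add: lincomb)
      fix u assume u: "(\<forall>A. A \<notin> S \<longrightarrow> u A = 0) \<and> q = coset_lincomb W u S"
      have "v - (\<Sum>v\<in>C. u (v +o W) *\<^sub>R v) \<in> W"
        using u v(2) coset_eq_iff[OF W(1)] by (simp add: lincomb)
      moreover have "v - y \<in> W" using xy by simp
      ultimately have "(v - y) - (v - (\<Sum>v\<in>C. u (v +o W) *\<^sub>R v)) \<in> W"
        by (rule subspace_diff[OF W(1), rotated])
      moreover have "(v - y) - (v - (\<Sum>v\<in>C. u (v +o W) *\<^sub>R v))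
          = (\<Sum>v\<in>C. (u (v +o W) - t v) *\<^sub>R v)"
        unfolding t scaleR_diff_left sum_subtractf by simp
      ultimately have "(\<Sum>v\<in>C. (u (v +o W) - t v) *\<^sub>R v) \<in> W" by simp
      from zero[OF this] have ut: "\<forall>v\<in>C. u (v +o W) = t v" by simp
      show "u = ?u"
      proof
        fix A
        show "u A = ?u A"
        proof (cases "A \<in> S")
          case True
          then obtain v where "v \<in> C" "A = v +o W" unfolding S_def by blast
          with ut True show ?thesis by (simp add: rC)
        next
          case False
          with u show ?thesis by simp
        qed
      qed
    qed
  qed
  then show ?thesis ..
qed

lemma quotient_dim_eq:
  fixes V W :: "'v::real_vector set"
  assumes "subspace W" "W \<subseteq> V" "subspace V" "V \<subseteq> span F" "finite F"
  shows "quotient_dim V W = dim V - dim W"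
  unfolding quotient_dim_def
  using quotient_basis_exists[OF assms] card_quotient_basis[OF assms]
  by (intro the_equality) auto

lemma dim_span_insert:
  fixes V :: "'v::real_vector set"
  assumes V: "subspace V" "V \<subseteq> span F" "finite F" and x: "x \<notin> V"
  shows "dim (span (insert x V)) = Suc (dim V)"
proof -
  obtain B where B: "finite B" "independent B" "span B = V" "card B = dim V"
    using finite_basis_of_subspace V by metis
  have "x \<notin> B" using x B(3) span_base by blast
  have "independent (insert x B)"
    using x B(2,3) by (simp add: independent_insertI)
  moreover have "span (insert x B) = span (insert x V)"
    unfolding span_insert B(3) span_eq_iff[THEN iffD2, OF V(1)] ..
  ultimately have "dim (span (insert x V)) = card (insert x B)"
    by (metis dim_span dim_eq_card_independent)
  with \<open>x \<notin> B\<close> B(1,4) show ?thesis by simp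
qed

section \<open>The boundary operator\<close>

lemma lookup_scaleR: "Poly_Mapping.lookup (r *\<^sub>R c) x = r *\<^sub>R Poly_Mapping.lookup c x"
proof -
  have "finite {x. r *\<^sub>R Poly_Mapping.lookup c x \<noteq> 0}"
    by (rule finite_subset[OF _ finite_lookup[of c]]) auto
  then show ?thesis
    by (simp add: scaleR_poly_mapping_def Abs_poly_mapping_inverse)
qed

lemma boundary_eq_sum:
  assumes "finite T" "Poly_Mapping.keys c \<subseteq> T"
  shows "boundary K k c = (\<Sum>\<tau>\<in>T. Poly_Mapping.lookup c \<tau> *\<^sub>R cell_boundary K k \<tau>)"
  unfolding boundary_def using assms
  by (intro sum.mono_neutral_left) (auto simp: in_keys_iff)

lemma linear_boundary: "linear (boundary K k)"
proof (rule linearI)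
  fix c d :: "'a \<Rightarrow>\<^sub>0 real" and r :: real
  let ?T = "Poly_Mapping.keys c \<union> Poly_Mapping.keys d"
  have "boundary K k (c + d)
      = (\<Sum>\<tau>\<in>?T. Poly_Mapping.lookup (c + d) \<tau> *\<^sub>R cell_boundary K k \<tau>)"
    using keys_add[of c d] by (intro boundary_eq_sum) auto
  also have "\<dots> = boundary K k c + boundary K k d"
    by (simp add: boundary_eq_sum[of ?T] lookup_add scaleR_add_left sum.distrib)
  finally show "boundary K k (c + d) = boundary K k c + boundary K k d" .
  have "boundary K k (r *\<^sub>R c)
      = (\<Sum>\<tau>\<in>Poly_Mapping.keys c. Poly_Mapping.lookup (r *\<^sub>R c) \<tau> *\<^sub>R cell_boundary K k \<tau>)"
    by (intro boundary_eq_sum) (auto simp: in_keys_iff lookup_scaleR)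
  also have "\<dots> = r *\<^sub>R boundary K k c"
    by (simp add: boundary_def lookup_scaleR scaleR_sum_right)
  finally show "boundary K k (r *\<^sub>R c) = r *\<^sub>R boundary K k c" .
qed

lemma boundary_single: "boundary K k (Poly_Mapping.single \<tau> a) = a *\<^sub>R cell_boundary K k \<tau>"
  by (subst boundary_eq_sum[of "{\<tau>}"]) simp_all

lemma cell_boundary_eq_0:
  assumes "\<forall>\<sigma>\<in>cells K. inc K \<tau> \<sigma> = 0"
  shows "cell_boundary K k \<tau> = 0"
  unfolding cell_boundary_def using assms by (intro sum.neutral) auto

lemma subspace_chains: "subspace (chains K k)"
proof (rule subspaceI)
  fix c d :: "'a \<Rightarrow>\<^sub>0 real" and r :: real
  show "c + d \<in> chains K k" if "c \<in> chains K k" "d \<in> chains K k"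
    using that keys_add[of c d] unfolding chains_def by blast
  show "r *\<^sub>R c \<in> chains K k" if "c \<in> chains K k"
    using that by (auto simp: chains_def in_keys_iff lookup_scaleR)
qed (simp add: chains_def)

lemma single_in_chains: "\<sigma> \<in> cells_of_dim K k \<Longrightarrow> Poly_Mapping.single \<sigma> a \<in> chains K k"
  by (auto simp: chains_def)

lemma poly_mapping_eq_sum_single:
  fixes c :: "'a \<Rightarrow>\<^sub>0 real"
  shows "c = (\<Sum>\<sigma>\<in>Poly_Mapping.keys c. Poly_Mapping.lookup c \<sigma> *\<^sub>R Poly_Mapping.single \<sigma> 1)"
proof (rule poly_mapping_eqI)
  fix \<tau>
  have "(\<Sum>\<sigma>\<in>Poly_Mapping.keys c.
      Poly_Mapping.lookup c \<sigma> * Poly_Mapping.lookup (Poly_Mapping.single \<sigma> 1) \<tau>)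
    = (\<Sum>\<sigma>\<in>Poly_Mapping.keys c. if \<tau> = \<sigma> then Poly_Mapping.lookup c \<sigma> else 0)"
    by (rule sum.cong) (auto simp: lookup_single)
  also have "\<dots> = Poly_Mapping.lookup c \<tau>"
    by (simp add: in_keys_iff)
  finally show "Poly_Mapping.lookup c \<tau> = Poly_Mapping.lookup
      (\<Sum>\<sigma>\<in>Poly_Mapping.keys c. Poly_Mapping.lookup c \<sigma> *\<^sub>R Poly_Mapping.single \<sigma> 1) \<tau>"
    by (simp add: lookup_sum lookup_scaleR)
qed

lemma chains_subset_span:
  "chains K k \<subseteq> span ((\<lambda>\<sigma>. Poly_Mapping.single \<sigma> 1) ` cells_of_dim K k)"
proof
  fix c assume "c \<in> chains K k"
  then have "(\<Sum>\<sigma>\<in>Poly_Mapping.keys c. Poly_Mapping.lookup c \<sigma> *\<^sub>R Poly_Mapping.single \<sigma> 1)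
      \<in> span ((\<lambda>\<sigma>. Poly_Mapping.single \<sigma> 1) ` cells_of_dim K k)"
    by (intro span_sum span_scale span_base) (auto simp: chains_def)
  then show "c \<in> span ((\<lambda>\<sigma>. Poly_Mapping.single \<sigma> 1) ` cells_of_dim K k)"
    by (subst poly_mapping_eq_sum_single)
qed

lemma subspace_cycles: "subspace (cycles K k)"
proof -
  have "cycles K k = chains K k \<inter> {c. boundary K k c = 0}"
    by (auto simp: cycles_def)
  then show ?thesis
    by (simp add: subspace_inter subspace_chains linear_subspace_kernel linear_boundary)
qed

lemma subspace_boundaries: "subspace (boundaries K k)"
  unfolding boundaries_def
  by (rule linear_subspace_image[OF linear_boundary subspace_chains])

text \<open>
  The coefficients of the boundary of \<open>cell_boundary K (Suc k) \<tau>\<close> are the sums in (L2). The sum over the cells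
  of dimension \<open>k\<close> may replace the sum over the faces of \<open>\<tau>\<close> because the incidence numbers of all other
  such cells vanish.
\<close>

lemma cell_boundary_in_cycles:
  assumes K: "lefschetz_complex K" and \<tau>: "\<tau> \<in> cells_of_dim K (Suc k)"
  shows "cell_boundary K (Suc k) \<tau> \<in> cycles K k"
proof -
  let ?S = "cells_of_dim K k"
  have fin: "finite (cells_of_dim K j)" for j
    using K by (simp add: lefschetz_complex_def)
  have \<tau>K: "\<tau> \<in> cells K" "cell_dim K \<tau> = Suc k"
    using \<tau> by (simp_all add: cells_of_dim_def)
  have faces: "{\<sigma> \<in> cells K. inc K \<tau> \<sigma> \<noteq> 0} \<subseteq> ?S"
  proof
    fix \<sigma> assume "\<sigma> \<in> {\<sigma> \<in> cells K. inc K \<tau> \<sigma> \<noteq> 0}"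
    then have "\<sigma> \<in> cells K" "int (cell_dim K \<tau>) - int (cell_dim K \<sigma>) = 1"
      using K \<tau>K(1) unfolding lefschetz_complex_def by blast+
    then show "\<sigma> \<in> ?S" using \<tau>K(2) by (simp add: cells_of_dim_def)
  qed
  have eq: "cell_boundary K (Suc k) \<tau> = (\<Sum>\<sigma>\<in>?S. Poly_Mapping.single \<sigma> (inc K \<tau> \<sigma>))"
    by (simp add: cell_boundary_def cells_of_dim_def)
  have "boundary K k (cell_boundary K (Suc k) \<tau>)
      = (\<Sum>\<sigma>\<in>?S. inc K \<tau> \<sigma> *\<^sub>R cell_boundary K k \<sigma>)"
    by (simp add: eq linear_sum[OF linear_boundary] boundary_single)
  also have "\<dots> = 0"
  proof (rule poly_mapping_eqI)
    fix \<nu>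
    let ?N = "{\<nu>. \<nu> \<in> cells K \<and> Suc (cell_dim K \<nu>) = k}"
    have "finite ?N"
      by (rule finite_subset[OF _ fin[of "k - 1"]]) (auto simp: cells_of_dim_def)
    then have lookup: "Poly_Mapping.lookup (cell_boundary K k \<sigma>) \<nu>
        = (if \<nu> \<in> ?N then inc K \<sigma> \<nu> else 0)" for \<sigma>
      by (simp add: cell_boundary_def lookup_sum lookup_single when_def)
    have "(\<Sum>\<sigma>\<in>?S. inc K \<tau> \<sigma> * (if \<nu> \<in> ?N then inc K \<sigma> \<nu> else 0)) = 0"
    proof (cases "\<nu> \<in> ?N")
      case False
      then show ?thesis by (simp only: if_False mult_zero_right sum.neutral_const)
    next
      case True
      have "(\<Sum>\<sigma>\<in>?S. inc K \<tau> \<sigma> * inc K \<sigma> \<nu>)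
          = (\<Sum>\<sigma> | \<sigma> \<in> cells K \<and> inc K \<tau> \<sigma> \<noteq> 0. inc K \<tau> \<sigma> * inc K \<sigma> \<nu>)"
        using fin faces by (intro sum.mono_neutral_right) (auto simp: cells_of_dim_def)
      also have "\<dots> = 0"
        using K \<tau>K(1) True by (simp add: lefschetz_complex_def)
      finally show ?thesis using True by (simp only: if_True)
    qed
    then show "Poly_Mapping.lookup (\<Sum>\<sigma>\<in>?S. inc K \<tau> \<sigma> *\<^sub>R cell_boundary K k \<sigma>) \<nu>
        = Poly_Mapping.lookup 0 \<nu>"
      by (simp only: lookup_sum lookup_scaleR lookup real_scaleR_def lookup_zero)
  qed
  finally have "boundary K k (cell_boundary K (Suc k) \<tau>) = 0" .
  moreover have "cell_boundary K (Suc k) \<tau> \<in> chains K k"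
    unfolding eq by (intro subspace_sum[OF subspace_chains] single_in_chains)
  ultimately show ?thesis by (simp add: cycles_def)
qed

lemma boundaries_subset_cycles:
  assumes "lefschetz_complex K"
  shows "boundaries K k \<subseteq> cycles K k"
proof
  fix b assume "b \<in> boundaries K k"
  then obtain c where "c \<in> chains K (Suc k)" "b = boundary K (Suc k) c"
    by (auto simp: boundaries_def)
  then show "b \<in> cycles K k"
    unfolding boundary_def
    by (auto simp: chains_def intro!: subspace_sum[OF subspace_cycles]
        subspace_scale[OF subspace_cycles] cell_boundary_in_cycles[OF assms])
qed

text \<open>
  Finitely many cells in each dimension give the finite spanning set required by \<open>quotient_dim_eq\<close>.
\<close>

lemma homology_rank_eq:
  assumes K: "lefschetz_complex K"
  shows "homology_rank K k = dim (cycles K k) - dim (boundaries K k)"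
  unfolding homology_rank_def
proof (rule quotient_dim_eq)
  show "cycles K k \<subseteq> span ((\<lambda>\<sigma>. Poly_Mapping.single \<sigma> 1) ` cells_of_dim K k)"
    using chains_subset_span by (auto simp: cycles_def)
  show "finite ((\<lambda>\<sigma>. Poly_Mapping.single \<sigma> (1::real)) ` cells_of_dim K k)"
    using K by (simp add: lefschetz_complex_def)
qed (use K in \<open>simp_all add: subspace_cycles subspace_boundaries boundaries_subset_cycles\<close>)


section \<open>Removal of an isolated cell\<close>

lemma cells_remove_cell [simp]: "cells (remove_cell K \<eta>) = cells K - {\<eta>}"
  and cell_dim_remove_cell [simp]: "cell_dim (remove_cell K \<eta>) = cell_dim K"
  and inc_remove_cell [simp]: "inc (remove_cell K \<eta>) = inc K"
  by (simp_all add: remove_cell_def)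

lemma chains_remove_cell:
  "chains (remove_cell K \<eta>) k = {c \<in> chains K k. Poly_Mapping.lookup c \<eta> = 0}"
  by (auto simp: chains_def cells_of_dim_def in_keys_iff)

text \<open>
  The cell \<open>\<eta>\<close> may occur in \<open>c\<close>: its boundary vanishes in both complexes, and it has coefficient \<open>0\<close>
  in the boundary of every other cell.
\<close>

lemma boundary_remove_cell:
  assumes K: "lefschetz_complex K" and \<eta>: "isolated_cell K \<eta>" and c: "c \<in> chains K k"
  shows "boundary (remove_cell K \<eta>) k c = boundary K k c"
proof -
  have "cell_boundary (remove_cell K \<eta>) k \<tau> = cell_boundary K k \<tau>" if "\<tau> \<in> cells K" for \<tau>
    unfolding cell_boundary_def
  proof (rule sum.mono_neutral_cong_left)
    have "finite (cells_of_dim K (k - 1))"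
      using K by (simp add: lefschetz_complex_def)
    then show "finite {\<sigma>. \<sigma> \<in> cells K \<and> Suc (cell_dim K \<sigma>) = k}"
      by (rule rev_finite_subset) (auto simp: cells_of_dim_def)
  qed (use \<eta> that in \<open>auto simp: isolated_cell_def\<close>)
  then show ?thesis
    unfolding boundary_def using c
    by (intro sum.cong) (auto simp: chains_def cells_of_dim_def)
qed

lemma boundary_single_isolated:
  assumes "isolated_cell K \<eta>"
  shows "boundary K k (Poly_Mapping.single \<eta> a) = 0"
  using assms by (simp add: boundary_single cell_boundary_eq_0 isolated_cell_def)

lemma chain_minus_cell:
  assumes "c \<in> chains K k"
  shows "c - Poly_Mapping.single \<eta> (Poly_Mapping.lookup c \<eta>) \<in> chains (remove_cell K \<eta>) k"
  using assms
  by (auto simp: chains_def cells_of_dim_def in_keys_iff lookup_minus lookup_single when_def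
      subset_iff split: if_splits)

lemma boundary_minus_isolated:
  assumes "isolated_cell K \<eta>"
  shows "boundary K k (c - Poly_Mapping.single \<eta> a) = boundary K k c"
  by (simp add: linear_diff[OF linear_boundary] boundary_single_isolated[OF assms])

text \<open>
  Deleting \<open>\<eta>\<close> from a chain of \<open>K\<close> does not change its boundary and leaves a chain of the smaller complex.
\<close>

lemma boundaries_remove_cell:
  assumes K: "lefschetz_complex K" and \<eta>: "isolated_cell K \<eta>"
  shows "boundaries (remove_cell K \<eta>) k = boundaries K k"
proof
  show "boundaries (remove_cell K \<eta>) k \<subseteq> boundaries K k"
    using boundary_remove_cell[OF K \<eta>] by (auto simp: boundaries_def chains_remove_cell)
  show "boundaries K k \<subseteq> boundaries (remove_cell K \<eta>) k"
  proof
    fix b assume "b \<in> boundaries K k"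
    then obtain c where c: "c \<in> chains K (Suc k)" "b = boundary K (Suc k) c"
      by (auto simp: boundaries_def)
    let ?c = "c - Poly_Mapping.single \<eta> (Poly_Mapping.lookup c \<eta>)"
    have c': "?c \<in> chains (remove_cell K \<eta>) (Suc k)"
      by (rule chain_minus_cell[OF c(1)])
    then have "?c \<in> chains K (Suc k)" by (simp add: chains_remove_cell)
    then have "b = boundary (remove_cell K \<eta>) (Suc k) ?c"
      by (simp add: c(2) boundary_remove_cell[OF K \<eta>] boundary_minus_isolated[OF \<eta>])
    with c' show "b \<in> boundaries (remove_cell K \<eta>) k" by (auto simp: boundaries_def)
  qed
qed

lemma cycles_remove_cell:
  assumes K: "lefschetz_complex K" and \<eta>: "isolated_cell K \<eta>"
  shows "cycles (remove_cell K \<eta>) k = {c \<in> cycles K k. Poly_Mapping.lookup c \<eta> = 0}"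
  using boundary_remove_cell[OF K \<eta>] by (auto simp: cycles_def chains_remove_cell)

lemma cycles_remove_cell_other_dim:
  assumes K: "lefschetz_complex K" and \<eta>: "isolated_cell K \<eta>" and "k \<noteq> cell_dim K \<eta>"
  shows "cycles (remove_cell K \<eta>) k = cycles K k"
proof -
  have "Poly_Mapping.lookup c \<eta> = 0" if "c \<in> cycles K k" for c
    using that assms(3) by (auto simp: cycles_def chains_def cells_of_dim_def in_keys_iff subset_iff)
  then show ?thesis by (auto simp: cycles_remove_cell[OF K \<eta>])
qed

text \<open>
  The coefficient of \<open>\<eta>\<close> in a cycle is arbitrary, as \<open>\<eta>\<close> is itself a cycle; subtracting that multiple
  of \<open>\<eta>\<close> leaves a cycle of the smaller complex.
\<close>

lemma cycles_eq_span_insert: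
  assumes K: "lefschetz_complex K" and \<eta>: "isolated_cell K \<eta>"
  shows "cycles K (cell_dim K \<eta>)
    = span (insert (Poly_Mapping.single \<eta> 1) (cycles (remove_cell K \<eta>) (cell_dim K \<eta>)))"
    (is "?Z = span (insert ?e ?Z')")
proof
  have "?e \<in> ?Z"
    using \<eta> by (auto simp: cycles_def boundary_single_isolated[OF \<eta>] isolated_cell_def
        cells_of_dim_def intro!: single_in_chains)
  moreover have "?Z' \<subseteq> ?Z" by (auto simp: cycles_remove_cell[OF K \<eta>])
  ultimately show "span (insert ?e ?Z') \<subseteq> ?Z"
    by (intro span_minimal subspace_cycles) simp
  show "?Z \<subseteq> span (insert ?e ?Z')"
  proof
    fix c assume c: "c \<in> ?Z"
    let ?a = "Poly_Mapping.lookup c \<eta>"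
    have e: "Poly_Mapping.single \<eta> ?a = ?a *\<^sub>R ?e"
      by (rule poly_mapping_eqI) (simp add: lookup_scaleR lookup_single when_def)
    have "c - ?a *\<^sub>R ?e \<in> ?Z"
      using c \<open>?e \<in> ?Z\<close> by (intro subspace_diff subspace_scale subspace_cycles)
    then have "c - ?a *\<^sub>R ?e \<in> ?Z'"
      by (simp add: cycles_remove_cell[OF K \<eta>] lookup_minus lookup_scaleR)
    then show "c \<in> span (insert ?e ?Z')"
      unfolding span_breakdown_eq by (blast intro: span_base)
  qed
qed

lemma homology_rank_remove_cell:
  assumes K: "lefschetz_complex K" and \<eta>: "isolated_cell K \<eta>"
  shows "homology_rank K k
    = homology_rank (remove_cell K \<eta>) k + (if k = cell_dim K \<eta> then 1 else 0)"
proof (cases "k = cell_dim K \<eta>")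
  case False
  then show ?thesis
    by (simp add: homology_rank_def boundaries_remove_cell[OF K \<eta>]
        cycles_remove_cell_other_dim[OF K \<eta>])
next
  case True
  let ?K' = "remove_cell K \<eta>"
  let ?F = "(\<lambda>\<sigma>. Poly_Mapping.single \<sigma> (1::real)) ` cells_of_dim ?K' k"
  have K': "lefschetz_complex ?K'"
    by (rule lefschetz_complex_remove_cell[OF K \<eta>])
  have Z': "cycles ?K' k \<subseteq> span ?F"
    using chains_subset_span by (auto simp: cycles_def)
  have finF: "finite ?F"
    using K' by (simp add: lefschetz_complex_def)
  have "Poly_Mapping.single \<eta> 1 \<notin> cycles ?K' k"
    by (simp add: cycles_remove_cell[OF K \<eta>])
  then have cyc: "dim (cycles K k) = Suc (dim (cycles ?K' k))"
    unfolding True cycles_eq_span_insert[OF K \<eta>]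
    using dim_span_insert[OF subspace_cycles Z' finF] True by simp
  obtain B where B: "finite B" "span B = cycles ?K' k" "card B = dim (cycles ?K' k)"
    by (rule finite_basis_of_subspace[OF subspace_cycles Z' finF])
  \<comment> \<open>The difference of dimensions is truncated, so the increment needs this inequality.\<close>
  have "dim (boundaries ?K' k) \<le> dim (cycles ?K' k)"
    using dim_le_card[of "boundaries ?K' k" B] boundaries_subset_cycles[OF K', of k] B by simp
  then show ?thesis
    using True cyc boundaries_remove_cell[OF K \<eta>, of k]
    by (simp add: homology_rank_eq K K' Suc_diff_le)
qed

lemma poincare_remove_cell:
  assumes "lefschetz_complex K" "isolated_cell K \<eta>"
  shows "poincare (remove_cell K \<eta>) = poincare K - fps_X ^ cell_dim K \<eta>"
  by (rule fps_ext)
    (simp add: poincare_def fps_X_power_nth homology_rank_remove_cell[OF assms])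

section \<open>Weakly critical cells\<close>

lemma U_snc_remove_cell:
  assumes "isolated_cell K \<eta>" "\<sigma> \<in> cells K"
  shows "U_snc (remove_cell K \<eta>) f \<sigma> = U_snc K f \<sigma>"
  unfolding U_snc_def using assms by (intro arg_cong[of _ _ card]) (auto simp: isolated_cell_def)

lemma D_snc_remove_cell:
  assumes "isolated_cell K \<eta>" "\<sigma> \<in> cells K"
  shows "D_snc (remove_cell K \<eta>) f \<sigma> = D_snc K f \<sigma>"
  unfolding D_snc_def using assms by (intro arg_cong[of _ _ card]) (auto simp: isolated_cell_def)

lemma snc_isolated_eq_0:
  assumes "isolated_cell K \<eta>"
  shows U_snc_isolated: "U_snc K f \<eta> = 0" and D_snc_isolated: "D_snc K f \<eta> = 0"
proof -
  have "{\<tau> \<in> cells K. inc K \<tau> \<eta> \<noteq> 0 \<and> f \<eta> > f \<tau>} = {}"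
    and "{\<nu> \<in> cells K. inc K \<eta> \<nu> \<noteq> 0 \<and> f \<eta> < f \<nu>} = {}"
    using assms unfolding isolated_cell_def by blast+
  then show "U_snc K f \<eta> = 0" "D_snc K f \<eta> = 0"
    by (simp_all only: U_snc_def D_snc_def card.empty)
qed

lemma discrete_morse_bott_remove_cell:
  assumes "isolated_cell K \<eta>" "discrete_morse_bott K f"
  shows "discrete_morse_bott (remove_cell K \<eta>) f"
  using assms(2)
  by (simp add: discrete_morse_bott_def U_snc_remove_cell[OF assms(1)] D_snc_remove_cell[OF assms(1)])

text \<open>
  The numbers \<open>U_snc\<close> and \<open>D_snc\<close> of the other cells do not count \<open>\<eta>\<close>, so the same cells stay weakly
  critical. This reduces the weakly critical complex to the general result on removal.
\<close>

lemma weakly_critical_complex_remove_cell: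
  assumes "isolated_cell K \<eta>"
  shows "weakly_critical_complex (remove_cell K \<eta>) f
    = remove_cell (weakly_critical_complex K f) \<eta>"
proof -
  have "weakly_critical (remove_cell K \<eta>) f \<sigma> \<longleftrightarrow> weakly_critical K f \<sigma> \<and> \<sigma> \<noteq> \<eta>" for \<sigma>
    by (cases "\<sigma> \<in> cells K")
      (simp_all add: weakly_critical_def U_snc_remove_cell[OF assms] D_snc_remove_cell[OF assms]
        conj_comms)
  then have "{\<sigma>. weakly_critical (remove_cell K \<eta>) f \<sigma>} = {\<sigma>. weakly_critical K f \<sigma>} - {\<eta>}"
    by blast
  then show ?thesis
    unfolding weakly_critical_complex_def inc_remove_cell cell_dim_remove_cell
    by (simp add: remove_cell_def[of "\<lparr>cells = _, cell_dim = _, inc = _\<rparr>"])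
qed

lemma isolated_cell_weakly_critical_complex:
  assumes "isolated_cell K \<eta>"
  shows "isolated_cell (weakly_critical_complex K f) \<eta>"
  using assms U_snc_isolated[OF assms, of f] D_snc_isolated[OF assms, of f]
  by (simp add: isolated_cell_def weakly_critical_complex_def weakly_critical_def)

text \<open>
  The removed cell was not counted, since its \<open>D_snc\<close> is \<open>0\<close> and not \<open>1\<close>.
\<close>

lemma d_snc_remove_cell:
  assumes "isolated_cell K \<eta>"
  shows "d_snc (remove_cell K \<eta>) f k = d_snc K f k"
proof -
  have "\<sigma> \<in> cells_of_dim (remove_cell K \<eta>) k \<and> D_snc (remove_cell K \<eta>) f \<sigma> = 1
      \<longleftrightarrow> \<sigma> \<in> cells_of_dim K k \<and> D_snc K f \<sigma> = 1" for \<sigma>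
    using D_snc_remove_cell[OF assms, of \<sigma> f] D_snc_isolated[OF assms, of f]
    by (cases "\<sigma> = \<eta>") (auto simp: cells_of_dim_def)
  then show ?thesis by (simp only: d_snc_def)
qed

theorem proposition5p9:
  fixes K :: "'a lefschetz" and f :: "'a \<Rightarrow> real" and \<eta> :: 'a
  assumes "lefschetz_complex K"
    and "discrete_morse_bott K f"
    and "isolated_cell K \<eta>"
  shows "discrete_morse_bott (remove_cell K \<eta>) f
    \<and> poincare (remove_cell K \<eta>) = poincare K - fps_X ^ cell_dim K \<eta>
    \<and> poincare (weakly_critical_complex (remove_cell K \<eta>) f)
        = poincare (weakly_critical_complex K f) - fps_X ^ cell_dim K \<eta>
    \<and> R_series K f = R_series (remove_cell K \<eta>) f"
proof (intro conjI)
  let ?W = "weakly_critical_complex K f"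
  note K = assms(1) and f = assms(2) and \<eta> = assms(3)
  have W: "lefschetz_complex ?W"
    by (rule lefschetz_complex_weakly_critical_complex[OF K f])
  have \<eta>W: "isolated_cell ?W \<eta>"
    by (rule isolated_cell_weakly_critical_complex[OF \<eta>])
  show "discrete_morse_bott (remove_cell K \<eta>) f"
    by (rule discrete_morse_bott_remove_cell[OF \<eta> f])
  show "poincare (remove_cell K \<eta>) = poincare K - fps_X ^ cell_dim K \<eta>"
    by (rule poincare_remove_cell[OF K \<eta>])
  have "cell_dim ?W = cell_dim K" by (simp add: weakly_critical_complex_def)
  then show "poincare (weakly_critical_complex (remove_cell K \<eta>) f)
      = poincare ?W - fps_X ^ cell_dim K \<eta>"
    using poincare_remove_cell[OF W \<eta>W]
    by (simp add: weakly_critical_complex_remove_cell[OF \<eta>])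
  show "R_series K f = R_series (remove_cell K \<eta>) f"
    by (simp add: R_series_def weakly_critical_complex_remove_cell[OF \<eta>]
        boundaries_remove_cell[OF K \<eta>] boundaries_remove_cell[OF W \<eta>W] d_snc_remove_cell[OF \<eta>])
qed

end
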